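(* There are no finite groups $G$ such that $o(G)=3$.
   Context: For a finite group $G$ and $x\in G$, $o(x)$ denotes the order of the element $x$. The sum of element orders is $\psi(G)=\sum_{x\in G}o(x)$, and the average order of $G$ is $o(G)=\frac{\psi(G)}{|G|}$. *)

theory Defs
  imports Complex_Main "HOL-Algebra.Algebra"
begin

text \<open>Both notions are meant for finite groups only: a sum over an infinite carrier is 0.\<close>

definition sum_orders :: "('a, 'b) monoid_scheme \<Rightarrow> nat" where
  "sum_orders G = (\<Sum>x\<in>carrier G. group.ord G x)"

definition average_order :: "('a, 'b) monoid_scheme \<Rightarrow> real" where
  "average_order G = real (sum_orders G) / real (order G)"

end

theory Submission
  imports Defs "HOL-Library.Disjoint_Sets" "HOL-Library.Z2"
begin

text \<open>
  Inversion preserves the order of an element, and it fixes no element of order greater than 2.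
  So if a set of elements of order greater than 2 is given by a condition on the order, then any
  natural-number function of the order has an even sum over it.

  In particular the elements of odd order other than \<open>\<one>\<close> contribute an even amount to
  \<open>sum_orders G\<close>, and so do the elements of even order. Only \<open>\<one>\<close> is left, with order 1, so
  \<open>sum_orders G\<close> is odd.

  If \<open>sum_orders G = 3 * n\<close> with \<open>n = order G\<close>, then \<open>n\<close> is odd. All orders are then odd by
  Lagrange, and the sum of \<open>(ord x - 1) / 2\<close> over \<open>x \<noteq> \<one>\<close> is even, so \<open>sum_orders G\<close> is
  congruent to \<open>n\<close> modulo 4. Hence 4 divides \<open>2 * n\<close>, which contradicts the parity of \<open>n\<close>.
\<close>

lemma even_sum_involution:
  fixes f :: "'a \<Rightarrow> nat"
  assumes "\<And>x. x \<in> S \<Longrightarrow> i x \<in> S" and "\<And>x. x \<in> S \<Longrightarrow> i (i x) = x"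
    and "\<And>x. x \<in> S \<Longrightarrow> i x \<noteq> x" and "\<And>x. x \<in> S \<Longrightarrow> f (i x) = f x"
  shows "even (\<Sum>x\<in>S. f x)"
proof -
  \<comment> \<open>Over the field with two elements the terms of each pair cancel.\<close>
  have "(\<Sum>x\<in>S. of_nat (f x) :: bit) = 0"
    using assms by (intro sum_involution_eq_0[where h = i]) auto
  then have "of_nat (\<Sum>x\<in>S. f x) = (0 :: bit)"
    by simp
  then show ?thesis
    by (metis even_of_nat_iff dvd_0_right)
qed

context group
begin

lemma inv_eq_self_imp_ord_le_2:
  assumes "x \<in> carrier G" and "inv x = x"
  shows "ord x \<le> 2"
proof -
  have "x [^] (2::nat) = \<one>"
    using assms r_inv[of x] by (simp add: numeral_2_eq_2)
  then have "ord x dvd 2"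
    using assms(1) pow_eq_id by blast
  then show ?thesis
    by (simp add: dvd_imp_le)
qed

lemma even_sum_over_inverse_pairs:
  fixes h :: "nat \<Rightarrow> nat"
  assumes "\<And>n. P n \<Longrightarrow> n > 2"
  shows "even (\<Sum>x | x \<in> carrier G \<and> P (ord x). h (ord x))"
proof (rule even_sum_involution[where i = "m_inv G"])
  show "inv x \<noteq> x" if "x \<in> {x \<in> carrier G. P (ord x)}" for x
    using that assms inv_eq_self_imp_ord_le_2[of x] by fastforce
qed auto

lemma odd_sum_orders:
  assumes "finite (carrier G)"
  shows "odd (sum_orders G)"
proof -
  let ?P = "\<lambda>n. odd n \<and> n > 2"
  let ?S = "{x \<in> carrier G. ?P (ord x)}"
  let ?R = "carrier G - ?S - {\<one>}"
  have "even (ord x)" if "x \<in> ?R" for x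
  proof (rule ccontr)
    assume "odd (ord x)"
    with that have "ord x = 1"
      by (cases "ord x \<le> 2") (auto simp: le_Suc_eq numeral_2_eq_2)
    with that show False
      using ord_eq_1 by blast
  qed
  then have "even (\<Sum>x\<in>?R. ord x)"
    by (intro dvd_sum) blast
  moreover have "even (\<Sum>x\<in>?S. ord x)"
    using even_sum_over_inverse_pairs[of ?P "\<lambda>n. n"] by blast
  moreover have "sum_orders G = (\<Sum>x\<in>carrier G - ?S. ord x) + (\<Sum>x\<in>?S. ord x)"
    unfolding sum_orders_def using assms by (intro sum.subset_diff) auto
  moreover have "(\<Sum>x\<in>carrier G - ?S. ord x) = ord \<one> + (\<Sum>x\<in>?R. ord x)"
    using assms by (intro sum.remove) auto
  ultimately show ?thesis by simp
qed

lemma sum_orders_mod_4: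
  assumes "finite (carrier G)" and "odd (order G)"
  shows "sum_orders G mod 4 = order G mod 4"
proof -
  let ?P = "\<lambda>n::nat. n > 2"
  let ?S = "{x \<in> carrier G. ?P (ord x)}"
  let ?h = "\<lambda>n::nat. (n - 1) div 2"
  have odd_ord: "odd (ord x)" if "x \<in> carrier G" for x
    using ord_dvd_group_order[OF that] assms(2) dvd_trans by blast
  have "even (\<Sum>x\<in>?S. ?h (ord x))"
    using even_sum_over_inverse_pairs[of ?P ?h] by blast
  \<comment> \<open>The summand vanishes at the orders up to 2, so the sum extends to the whole carrier.\<close>
  also have "(\<Sum>x\<in>?S. ?h (ord x)) = (\<Sum>x\<in>carrier G. ?h (ord x))"
    using assms(1) by (intro sum.mono_neutral_left) auto
  finally obtain k where k: "(\<Sum>x\<in>carrier G. ?h (ord x)) = 2 * k" ..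
  have "sum_orders G = (\<Sum>x\<in>carrier G. 2 * ?h (ord x) + 1)"
    unfolding sum_orders_def by (intro sum.cong) (auto dest!: odd_ord elim!: oddE)
  also have "\<dots> = order G + 4 * k"
    using k unfolding sum.distrib sum_distrib_left[symmetric] by (simp add: order_def)
  finally show ?thesis
    by simp
qed

end

theorem proposition2p6:
  fixes G :: "('a, 'b) monoid_scheme"
  assumes "group G" and "finite (carrier G)"
  shows "average_order G \<noteq> 3"
proof
  assume avg: "average_order G = 3"
  interpret group G by fact
  have "order G > 0"
    using assms(2) order_gt_0_iff_finite by blast
  with avg have "real (sum_orders G) = real (3 * order G)"
    by (simp add: average_order_def field_simps)
  then have eq: "sum_orders G = 3 * order G"
    by (simp only: of_nat_eq_iff)
  with odd_sum_orders[OF assms(2)] have "odd (order G)"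
    by simp
  moreover from this have "(3 * order G) mod 4 = order G mod 4"
    using sum_orders_mod_4 assms(2) eq by simp
  ultimately show False
    by presburger
qed

end
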